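(* Let $S$ be a commutative unital semiring with zero containing an element of infinite multiplicative order, and let $n$ be a positive integer. The hypoplactic monoid $\mathrm{hypo}_n$ of rank $n$ admits a faithful representation by upper triangular matrices of size $n^2$ over $S$ (that is, an injective monoid homomorphism $\mathrm{hypo}_n \to \mathrm{UT}_{n^2}(S)$) having block-diagonal structure with largest block of size $2$ (or size $1$ if $n=1$).
   Context: $[n]=\{1,\dots,n\}$, and $[n]^*$ is the free monoid on $[n]$. $\mathrm{UT}_m(S)$ is the monoid of $m\times m$ upper triangular matrices over the semiring $S$ (entries below the diagonal equal to $0_S$) under matrix multiplication. Quasi-ribbon tableaux: a quasi-ribbon tableau is a planar array of adjacent symbols (positive integers), each lying immediately to the east or immediately to the south of the previous one, such that rows are non-decreasing from left to right and columns are strictly increasing from top to bottom. Equivalently, it is a finite sequence of non-empty rows, each a non-decreasing word, where the first entry of each row is placed directly below the last entry of the preceding row and is strictly greater than it. Insertion $T\leftarrow a$ of a symbol $a$ into a quasi-ribbon tableau $T$: if no entry of $T$ is $\le a$, create a new entry $a$ and attach $T$ by its top-left-most entry to the bottom of $a$ (so $a$ is a new top row). If no entry of $T$ is $>a$, attach $a$ to the right of the bottom-right-most entry of $T$ (i.e. append $a$ to the last row). Otherwise let $x,z$ be the adjacent (consecutive) entries of $T$ with $x\le a<z$; keep the part of $T$ up to and including $x$, put $a$ to the right of $x$, and attach the remaining part of $T$ (from $z$ onwards) below $a$, so that $z$ starts a new row. (Inserting $a$ in the empty tableau yields the one-entry tableau $a$.) For a word $u$ over the positive integers, $\mathrm{P}_{\mathrm{hypo}}(u)$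 is the tableau obtained from the empty tableau by inserting the symbols of $u$ from left to right. The relation $u\equiv_{\mathrm{hypo}} v \iff \mathrm{P}_{\mathrm{hypo}}(u)=\mathrm{P}_{\mathrm{hypo}}(v)$ is a congruence, and $\mathrm{hypo}_n=[n]^*/{\equiv_{\mathrm{hypo}}}$. *)

theory Defs
  imports "Jordan_Normal_Form.Matrix"
begin

text \<open>A quasi-ribbon tableau is the list of its rows, from top to bottom; the first entry of
  each row sits directly below the last entry of the row before.\<close>

definition quasi_ribbon :: "nat list list \<Rightarrow> bool" where
  "quasi_ribbon T \<longleftrightarrow>
     (\<forall>r \<in> set T. r \<noteq> [] \<and> sorted r) \<and> successively (\<lambda>r r'. last r < hd r') T"

text \<open>The tableau formed by the entries satisfying \<open>Q\<close>; rows that become empty are dropped.\<close>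

definition qr_part :: "(nat \<Rightarrow> bool) \<Rightarrow> nat list list \<Rightarrow> nat list list" where
  "qr_part Q T = filter (\<lambda>r. r \<noteq> []) (map (filter Q) T)"

text \<open>Read row by row, a quasi-ribbon tableau is weakly increasing. If \<open>x \<le> a < z\<close> for
  consecutive entries \<open>x\<close> and \<open>z\<close>, the part up to \<open>x\<close> therefore consists of the entries
  \<open>\<le> a\<close> and the part from \<open>z\<close> on of the entries \<open>> a\<close>.\<close>

definition qr_insert :: "nat list list \<Rightarrow> nat \<Rightarrow> nat list list" where
  "qr_insert T a =
    (if \<forall>x \<in> set (concat T). \<not> x \<le> a then [a] # T
     else if \<forall>x \<in> set (concat T). \<not> x > a then butlast T @ [last T @ [a]]
     else let L = qr_part (\<lambda>x. x \<le> a) T; R = qr_part (\<lambda>x. x > a) T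
          in butlast L @ [last L @ [a]] @ R)"

definition P_hypo :: "nat list \<Rightarrow> nat list list" where
  "P_hypo u = foldl qr_insert [] u"

lemma quasi_ribbon_iff:
  "quasi_ribbon T \<longleftrightarrow> (\<forall>r \<in> set T. r \<noteq> [] \<and> sorted r) \<and>
     sorted_wrt (\<lambda>r r'. \<forall>x \<in> set r. \<forall>y \<in> set r'. x < y) T"
proof (induction T)
  case Nil
  then show ?case by (simp add: quasi_ribbon_def)
next
  case (Cons r T)
  show ?case
  proof (cases T)
    case Nil
    then show ?thesis by (auto simp: quasi_ribbon_def)
  next
    case (Cons s T')
    have step: "quasi_ribbon (r # T) \<longleftrightarrow> r \<noteq> [] \<and> sorted r \<and> last r < hd s \<and> quasi_ribbon T"
      using Cons by (auto simp: quasi_ribbon_def)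
    have "last r < hd s \<longleftrightarrow> (\<forall>r' \<in> set T. \<forall>x \<in> set r. \<forall>y \<in> set r'. x < y)"
      if r: "r \<noteq> []" "sorted r" and T: "quasi_ribbon T"
    proof
      have s: "s \<noteq> []" "sorted s" using T Cons by (auto simp: quasi_ribbon_def)
      { assume *: "last r < hd s"
        have 1: "x \<le> last r" if "x \<in> set r" for x
          using r that by (cases r rule: rev_cases) (auto simp: sorted_append)
        have 2: "hd s \<le> y" if "y \<in> set s" for y
          using s that by (cases s) auto
        have "\<forall>r' \<in> set T'. \<forall>y \<in> set r'. hd s < y"
          using T Cons.IH s Cons by auto
        then show "\<forall>r' \<in> set T. \<forall>x \<in> set r. \<forall>y \<in> set r'. x < y"
          using * 1 2 Cons by (force dest: le_less_trans less_le_trans) }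
      assume "\<forall>r' \<in> set T. \<forall>x \<in> set r. \<forall>y \<in> set r'. x < y"
      then show "last r < hd s" using r s Cons by auto
    qed
    then show ?thesis using step Cons.IH by auto
  qed
qed

lemma quasi_ribbon_part: "quasi_ribbon T \<Longrightarrow> quasi_ribbon (qr_part Q T)"
  unfolding quasi_ribbon_iff qr_part_def
  by (induction T) (auto simp: sorted_wrt_filter)

lemma concat_qr_part: "concat (qr_part Q T) = filter Q (concat T)"
  by (induction T) (auto simp: qr_part_def)

lemma quasi_ribbon_snoc:
  assumes "quasi_ribbon T" "T \<noteq> []" "\<forall>x \<in> set (concat T). x \<le> a"
  shows "quasi_ribbon (butlast T @ [last T @ [a]])"
proof -
  obtain T' r where T: "T = T' @ [r]" using assms(2) by (metis rev_exhaust)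
  have "r \<noteq> []" using assms(1) by (auto simp: T quasi_ribbon_def)
  then have r: "last r \<in> set r" by simp
  then have "last r \<le> a" using assms(3) by (simp add: T)
  moreover have "\<forall>s \<in> set T'. \<forall>x \<in> set s. x < last r"
    using assms(1) r unfolding quasi_ribbon_iff T by (simp add: sorted_wrt_append)
  ultimately have "\<forall>s \<in> set T'. \<forall>x \<in> set s. x < a"
    by (blast intro: less_le_trans)
  moreover have "\<forall>x \<in> set r. x \<le> a" using assms(3) by (simp add: T)
  ultimately show ?thesis
    using assms(1) unfolding quasi_ribbon_iff T
    by (simp add: sorted_wrt_append sorted_append[of r "[a]"] ball_Un)
qed

lemma quasi_ribbon_insert:
  assumes "quasi_ribbon T"
  shows "quasi_ribbon (qr_insert T a)"
proof -
  consider (top) "\<forall>x \<in> set (concat T). \<not> x \<le> a"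
    | (bot) "\<not> (\<forall>x \<in> set (concat T). \<not> x \<le> a)" "\<forall>x \<in> set (concat T). \<not> x > a"
    | (mid) "\<not> (\<forall>x \<in> set (concat T). \<not> x \<le> a)" "\<not> (\<forall>x \<in> set (concat T). \<not> x > a)"
    by blast
  then show ?thesis
  proof cases
    case top
    then show ?thesis
      using assms by (auto simp: qr_insert_def quasi_ribbon_iff not_le)
  next
    case bot
    then have "T \<noteq> []" by auto
    then have "quasi_ribbon (butlast T @ [last T @ [a]])"
      using assms bot(2) by (intro quasi_ribbon_snoc) (auto simp: not_less)
    moreover have "qr_insert T a = butlast T @ [last T @ [a]]"
      unfolding qr_insert_def if_not_P[OF bot(1)] if_P[OF bot(2)] by (rule refl)
    ultimately show ?thesis by simp
  next
    case mid
    define L where "L = qr_part (\<lambda>x. x \<le> a) T"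
    define R where "R = qr_part (\<lambda>x. x > a) T"
    have eq: "qr_insert T a = (butlast L @ [last L @ [a]]) @ R"
      unfolding qr_insert_def if_not_P[OF mid(1)] if_not_P[OF mid(2)] Let_def L_def R_def by simp
    have sL: "set (concat L) = {x \<in> set (concat T). x \<le> a}"
      unfolding L_def concat_qr_part by simp
    have sR: "set (concat R) = {x \<in> set (concat T). x > a}"
      unfolding R_def concat_qr_part by simp
    have "L \<noteq> []" using sL mid(1) by fastforce
    then have L': "quasi_ribbon (butlast L @ [last L @ [a]])"
      using assms sL by (intro quasi_ribbon_snoc) (auto simp: L_def quasi_ribbon_part)
    have R': "quasi_ribbon R" using assms by (simp add: R_def quasi_ribbon_part)
    have cL: "concat (butlast L @ [last L @ [a]]) = concat L @ [a]"
      using \<open>L \<noteq> []\<close> by (cases L rule: rev_cases) auto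
    have "\<forall>x \<in> set (concat (butlast L @ [last L @ [a]])). x \<le> a"
      unfolding cL set_append sL by simp
    then have "\<forall>x \<in> set (concat (butlast L @ [last L @ [a]])). \<forall>y \<in> set (concat R). x < y"
      unfolding sR by fastforce
    then have "\<forall>r \<in> set (butlast L @ [last L @ [a]]). \<forall>r' \<in> set R.
        \<forall>x \<in> set r. \<forall>y \<in> set r'. x < y"
      unfolding set_concat by blast
    then show ?thesis
      using L' R' unfolding eq quasi_ribbon_iff sorted_wrt_append[of _ "butlast L @ [last L @ [a]]" R]
      by (simp only: set_append[of "butlast L @ [last L @ [a]]" R]) blast
  qed
qed

lemma quasi_ribbon_P_hypo: "quasi_ribbon (P_hypo u)"
  by (induction u rule: rev_induct) (simp_all add: P_hypo_def quasi_ribbon_insert,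
      simp add: quasi_ribbon_def)

definition hypo_rel :: "nat \<Rightarrow> (nat list \<times> nat list) set" where
  "hypo_rel n = {(u, v). u \<in> lists {1..n} \<and> v \<in> lists {1..n} \<and> P_hypo u = P_hypo v}"

text \<open>The product of two classes is the class of the concatenation of representatives; since
  \<open>hypo_rel n\<close> is a congruence, the union below consists of a single class.\<close>

definition hypo :: "nat \<Rightarrow> nat list set monoid" where
  "hypo n = \<lparr> carrier = lists {1..n} // hypo_rel n,
              mult = (\<lambda>X Y. \<Union>x \<in> X. \<Union>y \<in> Y. hypo_rel n `` {x @ y}),
              one = hypo_rel n `` {[]} \<rparr>"

definition UT :: "nat \<Rightarrow> 'a :: comm_semiring_1 mat monoid" where
  "UT m = \<lparr> carrier = {A \<in> carrier_mat m m. upper_triangular A}, mult = (*), one = 1\<^sub>m m \<rparr>"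

definition block_diagonal :: "nat list \<Rightarrow> 'a :: zero mat \<Rightarrow> bool" where
  "block_diagonal ks A \<longleftrightarrow>
     (\<exists>Bs. map dim_row Bs = ks \<and> (\<forall>B \<in> set Bs. square_mat B) \<and> A = diag_block_mat Bs)"

end

theory Submission
  imports Defs
begin

text \<open>
  A quasi-ribbon tableau read row by row is the sorted word of its entries, so
  \<open>P_hypo u\<close> consists of the content of \<open>u\<close> together with the places where
  the sorted word is cut into rows. Inserting \<open>a\<close> makes a cut between \<open>a\<close> and the next
  larger entry, if there is one; it makes no other cut and removes none.
  Hence two values \<open>i < j\<close> of \<open>u\<close> end up in the same row precisely when
  the letters of \<open>u\<close> in the interval from \<open>i\<close> to \<open>j\<close> occur in weakly increasing order
  (\<open>row_mates_P_hypo\<close>). It suffices to know this for neighbouring values of the support,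
  because sortedness on two intervals that share a value of \<open>u\<close> as an end point extends to
  their union (\<open>sorted_between_glue\<close>). So two words have the same tableau
  iff they have the same content and agree, for all neighbouring values \<open>i < j\<close> of their support,
  on whether all letters \<open>i\<close> precede all letters \<open>j\<close> (\<open>P_hypo_eq_iff_neighbours\<close>).

  Both kinds of data are read off multiplicatively. The number of letters \<open>i\<close> is the exponent of
  the \<open>1 \<times> 1\<close> matrix \<open>(s ^ k)\<close>, where \<open>s\<close> has infinite order. For \<open>i < j\<close> send
  \<open>i\<close> to \<open>I = (1, 0; 0, 0)\<close> and \<open>j\<close> to \<open>J = (0, 1; 0, 1)\<close>, the letters strictly between them to
  the zero matrix and all others to the identity. Here \<open>I\<close> and \<open>J\<close> are idempotent,
  \<open>I J = (0, 1; 0, 0)\<close> and \<open>J I = 0\<close>: the product vanishes as soon as some \<open>j\<close> precedes some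
  \<open>i\<close> or a value between them occurs, and otherwise it depends only on which of \<open>i\<close> and \<open>j\<close>
  occur. These matrices do not count letters, so over any semiring with \<open>0 \<noteq> 1\<close> all products have
  entries \<open>0\<close> and \<open>1\<close> only.
  There are \<open>n\<close> blocks of size 1 and \<open>n (n - 1) / 2\<close> blocks of size 2, which makes \<open>n\<^sup>2\<close> rows.
\<close>

section \<open>Rows of quasi-ribbon tableaux\<close>

definition row_mates :: "nat list list \<Rightarrow> nat \<Rightarrow> nat \<Rightarrow> bool" where
  "row_mates T i j \<longleftrightarrow> (\<exists>r \<in> set T. i \<in> set r \<and> j \<in> set r)"

lemma row_mates_imp_entries:
  "row_mates T i j \<Longrightarrow> i \<in> set (concat T) \<and> j \<in> set (concat T)"
  by (auto simp: row_mates_def)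

lemma row_mates_Cons:
  "row_mates (r # T) i j \<longleftrightarrow> i \<in> set r \<and> j \<in> set r \<or> row_mates T i j"
  by (auto simp: row_mates_def)

lemma row_mates_append:
  "row_mates (T @ T') i j \<longleftrightarrow> row_mates T i j \<or> row_mates T' i j"
  by (auto simp: row_mates_def)

lemma row_mates_sym: "row_mates T i j \<longleftrightarrow> row_mates T j i"
  by (auto simp: row_mates_def)

lemma quasi_ribbon_Cons:
  "quasi_ribbon (r # T) \<longleftrightarrow>
     r \<noteq> [] \<and> sorted r \<and> (\<forall>x \<in> set r. \<forall>y \<in> set (concat T). x < y) \<and> quasi_ribbon T"
  unfolding quasi_ribbon_iff by auto

lemma sorted_concat_quasi_ribbon: "quasi_ribbon T \<Longrightarrow> sorted (concat T)"
proof (induction T)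
  case (Cons r T)
  then have "sorted (concat T)" "sorted r" "\<forall>x \<in> set r. \<forall>y \<in> set (concat T). x < y"
    unfolding quasi_ribbon_Cons by blast+
  then show ?case
    by (simp add: sorted_append del: set_concat) (blast intro: less_imp_le)
qed simp

text \<open>The first row is recovered from the reading word and the relation: its first entry is the first
  letter, and its other entries are those that share a row with that letter.
  Stripping this row from both tableaux allows induction.\<close>

lemma quasi_ribbon_eqI:
  assumes "quasi_ribbon T" "quasi_ribbon T'" "concat T = concat T'"
    and "\<And>i j. row_mates T i j \<longleftrightarrow> row_mates T' i j"
  shows "T = T'"
  using assms
proof (induction T arbitrary: T')
  case Nil
  then show ?case by (cases T') (auto simp: quasi_ribbon_Cons)
next
  case (Cons r T)
  then obtain r' T1 where T': "T' = r' # T1"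
    by (cases T') (auto simp: quasi_ribbon_Cons)
  have r: "r \<noteq> []" "\<forall>x \<in> set r. \<forall>y \<in> set (concat T). x < y" "quasi_ribbon T"
    using Cons.prems(1) by (auto simp: quasi_ribbon_Cons)
  have r': "r' \<noteq> []" "\<forall>x \<in> set r'. \<forall>y \<in> set (concat T1). x < y" "quasi_ribbon T1"
    using Cons.prems(2) by (auto simp: quasi_ribbon_Cons T')
  have c: "r @ concat T = r' @ concat T1" using Cons.prems(3) by (simp add: T')
  have hd: "hd r = hd r'" using arg_cong[OF c, of hd] r(1) r'(1) by simp
  have hd_notin: "hd r \<notin> set (concat T)" "hd r' \<notin> set (concat T1)"
    using r(1,2) r'(1,2) hd_in_set less_irrefl by blast+
  have 1: "x \<in> set r \<longleftrightarrow> row_mates (r # T) (hd r) x" for x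
    using r(1) hd_notin(1) row_mates_imp_entries[of T] hd_in_set by (metis row_mates_Cons)
  have 2: "x \<in> set r' \<longleftrightarrow> row_mates (r' # T1) (hd r') x" for x
    using r'(1) hd_notin(2) row_mates_imp_entries[of T1] hd_in_set by (metis row_mates_Cons)
  have s: "set r = set r'"
  proof (rule Set.set_eqI)
    fix x
    have "x \<in> set r \<longleftrightarrow> row_mates T' (hd r) x" using 1[of x] Cons.prems(4)[of "hd r" x] by (rule trans)
    also have "\<dots> \<longleftrightarrow> x \<in> set r'" unfolding hd T' by (rule 2[symmetric])
    finally show "x \<in> set r \<longleftrightarrow> x \<in> set r'" .
  qed
  have "filter (\<lambda>x. x \<in> set r) (r @ concat T) = r"
    using r(2) less_irrefl by (simp add: filter_empty_conv del: set_concat) blast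
  moreover have "filter (\<lambda>x. x \<in> set r') (r' @ concat T1) = r'"
    using r'(2) less_irrefl by (simp add: filter_empty_conv del: set_concat) blast
  ultimately have req: "r = r'" using c s by simp
  have a: "row_mates T i j \<longleftrightarrow> row_mates (r # T) i j \<and> i \<notin> set r" for i j
    using r(2) row_mates_imp_entries[of T i j] less_irrefl unfolding row_mates_Cons by blast
  have b: "row_mates T1 i j \<longleftrightarrow> row_mates (r' # T1) i j \<and> i \<notin> set r'" for i j
    using r'(2) row_mates_imp_entries[of T1 i j] less_irrefl unfolding row_mates_Cons by blast
  have "T = T1"
  proof (rule Cons.IH[OF r(3) r'(3)])
    show "concat T = concat T1" using c req by simp
    show "row_mates T i j \<longleftrightarrow> row_mates T1 i j" for i j
      unfolding a b using Cons.prems(4)[of i j] unfolding T' req by simp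
  qed
  then show ?case using req T' by simp
qed

section \<open>The effect of an insertion on the rows\<close>

lemma qr_part_eq_Nil_iff: "qr_part Q T = [] \<longleftrightarrow> (\<forall>x \<in> set (concat T). \<not> Q x)"
  by (induction T) (auto simp: qr_part_def filter_empty_conv)

lemma qr_part_eq_self:
  "quasi_ribbon T \<Longrightarrow> \<forall>x \<in> set (concat T). Q x \<Longrightarrow> qr_part Q T = T"
proof (induction T)
  case (Cons r T)
  then have "filter Q r = r" "r \<noteq> []" "qr_part Q T = T"
    by (auto simp: quasi_ribbon_Cons)
  then show ?case by (simp add: qr_part_def)
qed (simp add: qr_part_def)

lemma row_mates_qr_part: "row_mates (qr_part Q T) i j \<longleftrightarrow> row_mates T i j \<and> Q i \<and> Q j"
proof (induction T)
  case Nil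
  then show ?case by (simp add: qr_part_def row_mates_def)
next
  case (Cons r T)
  have "row_mates (qr_part Q (r # T)) i j
      \<longleftrightarrow> i \<in> set (filter Q r) \<and> j \<in> set (filter Q r) \<or> row_mates (qr_part Q T) i j"
    by (cases "filter Q r") (simp_all add: qr_part_def row_mates_Cons)
  then show ?case unfolding Cons.IH row_mates_Cons by auto
qed

text \<open>In the first two cases of the insertion one of the parts, of the entries \<open>\<le> a\<close> and of the
  entries \<open>> a\<close>, is empty and the other is the whole tableau, so a single formula covers all three cases.\<close>

lemma qr_insert_eq:
  fixes a :: nat
  assumes "quasi_ribbon T"
  defines "L \<equiv> qr_part (\<lambda>x. x \<le> a) T"
  shows "qr_insert T a =
    (if L = [] then [[a]] else butlast L @ [last L @ [a]]) @ qr_part (\<lambda>x. x > a) T"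
proof -
  consider (top) "\<forall>x \<in> set (concat T). \<not> x \<le> a"
    | (bot) "\<not> (\<forall>x \<in> set (concat T). \<not> x \<le> a)" "\<forall>x \<in> set (concat T). \<not> x > a"
    | (mid) "\<not> (\<forall>x \<in> set (concat T). \<not> x \<le> a)" "\<not> (\<forall>x \<in> set (concat T). \<not> x > a)"
    by blast
  then show ?thesis
  proof cases
    case top
    have "L = []" unfolding L_def qr_part_eq_Nil_iff by (fact top)
    moreover have "qr_part (\<lambda>x. x > a) T = T"
      using assms(1) top by (intro qr_part_eq_self) (auto simp: not_le)
    ultimately show ?thesis unfolding qr_insert_def if_P[OF top] by simp
  next
    case bot
    have "L = T" unfolding L_def
      using assms(1) bot(2) by (intro qr_part_eq_self) (auto simp: not_less)
    moreover have "T \<noteq> []" using bot(1) by auto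
    moreover have "qr_part (\<lambda>x. x > a) T = []" unfolding qr_part_eq_Nil_iff by (fact bot(2))
    ultimately show ?thesis
      unfolding qr_insert_def if_not_P[OF bot(1)] if_P[OF bot(2)] by simp
  next
    case mid
    have "L \<noteq> []" unfolding L_def qr_part_eq_Nil_iff by (fact mid(1))
    then show ?thesis
      unfolding qr_insert_def if_not_P[OF mid(1)] if_not_P[OF mid(2)] Let_def L_def by simp
  qed
qed

lemma mset_concat_qr_insert:
  assumes "quasi_ribbon T"
  shows "mset (concat (qr_insert T a)) = add_mset a (mset (concat T))"
proof -
  define L where "L = qr_part (\<lambda>x. x \<le> a) T"
  have 1: "mset (concat (if L = [] then [[a]] else butlast L @ [last L @ [a]]))
      = add_mset a (mset (concat L))"
    by (cases L rule: rev_cases) auto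
  have 2: "mset (concat T) =
      mset (filter (\<lambda>x. x \<le> a) (concat T)) + mset (filter (\<lambda>x. x > a) (concat T))"
    using multiset_partition[of "mset (concat T)" "\<lambda>x. x \<le> a"]
    unfolding mset_filter not_le .
  show ?thesis
    unfolding qr_insert_eq[OF assms] L_def[symmetric] concat_append mset_append concat_qr_part 1
    unfolding L_def concat_qr_part 2 by simp
qed

text \<open>The new entry \<open>a\<close> joins the row of the largest entry \<open>m \<le> a\<close>; if there is no such
  entry, it starts a row of its own. The only pairs that are
  separated are those on either side of the cut after \<open>a\<close>.\<close>

lemma row_mates_qr_insert:
  assumes T: "quasi_ribbon T" and "i \<le> j"
  shows "row_mates (qr_insert T a) i j \<longleftrightarrow>
    (if j = a then i = a \<or>
       (\<exists>m \<le> a. row_mates T i m \<and> (\<forall>y \<in> set (concat T). y \<le> a \<longrightarrow> y \<le> m))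
     else row_mates T i j \<and> \<not> (i \<le> a \<and> a < j))"
proof -
  define L where "L = qr_part (\<lambda>x. x \<le> a) T"
  define L' where "L' = (if L = [] then [[a]] else butlast L @ [last L @ [a]])"
  have L: "quasi_ribbon L" unfolding L_def by (rule quasi_ribbon_part[OF T])
  have Lset: "y \<in> set (concat L) \<longleftrightarrow> y \<in> set (concat T) \<and> y \<le> a" for y
    by (simp add: L_def concat_qr_part del: set_concat)
  have split: "row_mates (qr_insert T a) i j \<longleftrightarrow> row_mates L' i j \<or> row_mates T i j \<and> a < i \<and> a < j"
    unfolding qr_insert_eq[OF T] row_mates_append row_mates_qr_part L'_def L_def by blast
  have Lm: "row_mates L x y \<longleftrightarrow> row_mates T x y \<and> x \<le> a \<and> y \<le> a" for x y
    unfolding L_def row_mates_qr_part by blast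
  show ?thesis
  proof (cases "j = a")
    case False
    have "row_mates L' i j \<longleftrightarrow> row_mates L i j" if "i \<noteq> a"
      using that False by (cases L rule: rev_cases) (auto simp: L'_def row_mates_def)
    moreover have "\<not> row_mates L' i j" if "a < j"
    proof
      assume "row_mates L' i j"
      then have "row_mates L j j" using False
        by (cases L rule: rev_cases) (auto simp: L'_def row_mates_def)
      then show False using that by (simp add: Lm)
    qed
    moreover have "i = a \<Longrightarrow> a < j" using False \<open>i \<le> j\<close> by simp
    ultimately show ?thesis using False \<open>i \<le> j\<close> unfolding split Lm by (cases "i = a") auto
  next
    case True
    show ?thesis
    proof (cases "i = a")
      case True
      have "row_mates L' a a" by (auto simp: L'_def row_mates_def)
      then show ?thesis using split True \<open>j = a\<close> by simp
    next
      case False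
      then have ia: "i < a" using \<open>i \<le> j\<close> True by simp
      show ?thesis
      proof (cases L rule: rev_cases)
        case Nil
        have "\<not> row_mates T i m" if "m \<le> a" for m
          using Lm[of i m] Nil that ia by (auto simp: row_mates_def)
        moreover have "\<not> row_mates L' i a" using Nil False by (simp add: L'_def row_mates_def)
        ultimately show ?thesis using split ia \<open>j = a\<close> by auto
      next
        case (snoc Ls r)
        have r: "r \<noteq> []" "sorted r" "\<forall>x \<in> set (concat Ls). \<forall>y \<in> set r. x < y"
          using L unfolding quasi_ribbon_iff snoc by (auto simp: sorted_wrt_append)
        have "last r \<in> set r" using r(1) by simp
        have ra: "\<forall>y \<in> set r. y \<le> a" using Lset by (auto simp: snoc)
        have L': "L' = Ls @ [r @ [a]]" by (simp add: L'_def snoc)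
        have a: "a \<notin> set (concat Ls)" using r(3) ra \<open>last r \<in> set r\<close> by (meson leD)
        \<comment> \<open>The last entry of the last row of \<open>L\<close> is the largest entry \<open>\<le> a\<close>, which makes it the
          witness \<open>m\<close>.\<close>
        have max: "y \<le> last r" if "y \<in> set (concat L)" for y
        proof -
          have "sorted (concat L)" by (rule sorted_concat_quasi_ribbon[OF L])
          moreover have "concat L = (concat Ls @ butlast r) @ [last r]"
            using r(1) by (simp add: snoc)
          ultimately show ?thesis using that by (auto simp: sorted_append)
        qed
        have "row_mates L' i a \<longleftrightarrow> i \<in> set r"
          using a False by (auto simp: L' row_mates_def)
        also have "\<dots> \<longleftrightarrow>
          (\<exists>m \<le> a. row_mates T i m \<and> (\<forall>y \<in> set (concat T). y \<le> a \<longrightarrow> y \<le> m))"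
        proof
          assume "i \<in> set r"
          then have "row_mates L i (last r)" using r(1) by (auto simp: snoc row_mates_def)
          then show "\<exists>m \<le> a. row_mates T i m \<and> (\<forall>y \<in> set (concat T). y \<le> a \<longrightarrow> y \<le> m)"
            using max Lm Lset by blast
        next
          assume "\<exists>m \<le> a. row_mates T i m \<and> (\<forall>y \<in> set (concat T). y \<le> a \<longrightarrow> y \<le> m)"
          then obtain m where m: "row_mates L i m" "\<forall>y \<in> set (concat L). y \<le> m"
            using Lm Lset ia by (meson less_imp_le)
          have "m \<notin> set (concat Ls)"
            using m(2) r(3) \<open>last r \<in> set r\<close> unfolding snoc by (fastforce dest: leD)
          then show "i \<in> set r" using m(1) by (auto simp: snoc row_mates_def)
        qed
        finally show ?thesis using split False ia \<open>j = a\<close> by auto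
      qed
    qed
  qed
qed

section \<open>Invariants of hypoplactic classes\<close>

definition between :: "nat \<Rightarrow> nat \<Rightarrow> nat list \<Rightarrow> nat list" where
  "between i j u = filter (\<lambda>x. i \<le> x \<and> x \<le> j) u"

lemma between_append: "between i j (u @ v) = between i j u @ between i j v"
  by (simp add: between_def)

lemma set_between: "set (between i j u) = {x \<in> set u. i \<le> x \<and> x \<le> j}"
  by (auto simp: between_def)

lemma P_hypo_snoc: "P_hypo (u @ [a]) = qr_insert (P_hypo u) a"
  by (simp add: P_hypo_def)

lemma mset_concat_P_hypo: "mset (concat (P_hypo u)) = mset u"
proof (induction u rule: rev_induct)
  case Nil
  then show ?case by (simp add: P_hypo_def)
next
  case (snoc a u)
  then show ?case
    using mset_concat_qr_insert[OF quasi_ribbon_P_hypo, of u a] by (simp add: P_hypo_snoc)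
qed

lemma set_concat_P_hypo: "set (concat (P_hypo u)) = set u"
  by (rule mset_eq_setD[OF mset_concat_P_hypo])

lemma concat_P_hypo: "concat (P_hypo u) = sort u"
  using sorted_concat_quasi_ribbon[OF quasi_ribbon_P_hypo] mset_concat_P_hypo
  by (metis properties_for_sort)

lemma sorted_constant: "\<forall>x \<in> set xs. x = c \<Longrightarrow> sorted xs"
  by (induction xs) auto

text \<open>When a letter \<open>a\<close> is appended, a pair separated by the cut has \<open>i \<le> a < j\<close>, and then \<open>a\<close> comes
  after the larger letter \<open>j\<close>. In the case \<open>j = a\<close> the new letter cannot disturb the order,
  and the interval up to \<open>a\<close> contains the same old letters as the interval up to the largest
  old letter \<open>m \<le> a\<close>, whose row \<open>a\<close> joins.\<close>

lemma row_mates_P_hypo: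
  "i \<le> j \<Longrightarrow> row_mates (P_hypo u) i j \<longleftrightarrow> i \<in> set u \<and> j \<in> set u \<and> sorted (between i j u)"
proof (induction u arbitrary: i j rule: rev_induct)
  case Nil
  then show ?case by (simp add: P_hypo_def row_mates_def)
next
  case (snoc a u)
  note mates = row_mates_qr_insert[OF quasi_ribbon_P_hypo[of u] snoc.prems, of a, folded P_hypo_snoc,
      unfolded set_concat_P_hypo]
  show ?case
  proof (cases "j = a")
    case False
    show ?thesis
    proof (cases "i \<le> a \<and> a < j")
      case True
      then have "\<not> (j \<in> set u \<and> sorted (between i j (u @ [a])))"
        by (auto simp: between_def sorted_append)
      then show ?thesis using mates False True by auto
    next
      case out: False
      then have "between i j (u @ [a]) = between i j u"
        using False by (auto simp: between_def)
      moreover have "i \<noteq> a" using out False snoc.prems by auto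
      ultimately show ?thesis using mates False out snoc.IH[OF snoc.prems] by auto
    qed
  next
    case True
    show ?thesis
    proof (cases "i = a")
      case ia: True
      have "sorted (between i j (u @ [a]))"
        by (rule sorted_constant[of _ a]) (auto simp: set_between True ia)
      then show ?thesis using mates True ia by auto
    next
      case False
      then have ia: "i < a" using True snoc.prems by simp
      have srt: "sorted (between i a (u @ [a])) \<longleftrightarrow> sorted (between i a u)"
        using ia by (auto simp: between_def sorted_append)
      have eq: "row_mates (P_hypo u) i m \<longleftrightarrow> i \<in> set u \<and> sorted (between i a u)"
        if m: "m \<in> set u" "i \<le> m" "m \<le> a" "\<forall>y \<in> set u. y \<le> a \<longrightarrow> y \<le> m" for m
      proof -
        have "between i a u = between i m u"
          unfolding between_def using m by (intro filter_cong) auto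
        then show ?thesis using snoc.IH[OF m(2)] m(1) by simp
      qed
      have "(\<exists>m \<le> a. row_mates (P_hypo u) i m \<and> (\<forall>y \<in> set u. y \<le> a \<longrightarrow> y \<le> m))
        \<longleftrightarrow> i \<in> set u \<and> sorted (between i a u)" (is "?lhs \<longleftrightarrow> ?rhs")
      proof
        assume ?lhs
        then obtain m where m: "m \<le> a" "row_mates (P_hypo u) i m"
          "\<forall>y \<in> set u. y \<le> a \<longrightarrow> y \<le> m" by blast
        have "i \<in> set u" "m \<in> set u"
          using row_mates_imp_entries[OF m(2)] by (simp_all only: set_concat_P_hypo)
        then show ?rhs using eq[of m] m ia by auto
      next
        assume rhs: ?rhs
        define m where "m = Max {y \<in> set u. y \<le> a}"
        have ne: "{y \<in> set u. y \<le> a} \<noteq> {}" "finite {y \<in> set u. y \<le> a}"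
          using rhs ia by auto
        have "m \<in> set u" "m \<le> a" "\<forall>y \<in> set u. y \<le> a \<longrightarrow> y \<le> m"
          using Max_in[OF ne(2,1)] ne by (auto simp: m_def)
        moreover have "i \<le> m" using calculation rhs ia by auto
        ultimately show ?lhs using eq[of m] rhs by blast
      qed
      then show ?thesis using mates True False srt by auto
    qed
  qed
qed

lemma P_hypo_eq_iff:
  "P_hypo u = P_hypo v \<longleftrightarrow> mset u = mset v \<and>
     (\<forall>i \<in> set u. \<forall>j \<in> set u. i \<le> j \<longrightarrow> sorted (between i j u) = sorted (between i j v))"
  (is "?lhs \<longleftrightarrow> ?rhs")
proof
  assume ?lhs
  then have m: "mset u = mset v" by (metis mset_concat_P_hypo)
  with \<open>?lhs\<close> show ?rhs using row_mates_P_hypo[of _ _ u] row_mates_P_hypo[of _ _ v] mset_eq_setD[OF m]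
    by auto
next
  assume r: ?rhs
  then have s: "set u = set v" by (auto dest: mset_eq_setD)
  have *: "row_mates (P_hypo u) i j \<longleftrightarrow> row_mates (P_hypo v) i j" if "i \<le> j" for i j
    unfolding row_mates_P_hypo[OF that] using r s that by auto
  have "row_mates (P_hypo u) i j \<longleftrightarrow> row_mates (P_hypo v) i j" for i j
    using *[of i j] *[of j i] row_mates_sym by (cases "i \<le> j") auto
  moreover have "concat (P_hypo u) = concat (P_hypo v)"
    unfolding concat_P_hypo using r by (simp add: properties_for_sort)
  ultimately show ?lhs by (intro quasi_ribbon_eqI quasi_ribbon_P_hypo)
qed

text \<open>This is the upper right entry of the \<open>2 \<times> 2\<close> block for \<open>i < j\<close>. The occurrence of \<open>j\<close> is
  demanded, but not that of \<open>i\<close>, because the matrix \<open>(0, 1; 0, 1)\<close> of \<open>j\<close>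
  has a \<open>1\<close> in this position, whereas the matrix \<open>(1, 0; 0, 0)\<close> of \<open>i\<close> has a \<open>0\<close>.\<close>

definition neighbours_sorted :: "nat \<Rightarrow> nat \<Rightarrow> nat list \<Rightarrow> bool" where
  "neighbours_sorted i j u \<longleftrightarrow>
     j \<in> set u \<and> set u \<inter> {i<..<j} = {} \<and> sorted (between i j u)"

lemma sorted_between_mono:
  "sorted (between i j u) \<Longrightarrow> i \<le> k \<Longrightarrow> l \<le> j \<Longrightarrow> sorted (between k l u)"
proof -
  assume *: "sorted (between i j u)" "i \<le> k" "l \<le> j"
  have "between k l u = filter (\<lambda>x. k \<le> x \<and> x \<le> l) (between i j u)"
    unfolding between_def filter_filter using *(2,3) by (intro filter_cong) auto
  then show ?thesis using *(1) sorted_filter[of id] by simp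
qed

text \<open>Split \<open>u\<close> at an occurrence of \<open>m\<close>. Before it there is no letter in \<open>{m<..j}\<close>, after it none in
  \<open>{i..<m}\<close>; so the two sorted parts lie on either side of that occurrence.\<close>

lemma sorted_between_glue:
  assumes m: "m \<in> set u" and "sorted (between i m u)" "sorted (between m j u)" "i \<le> m" "m \<le> j"
  shows "sorted (between i j u)"
proof -
  obtain xs ys where u: "u = xs @ m # ys" using split_list[OF m] by blast
  have "sorted (between i m xs @ m # between i m ys)"
    using assms(2,4) by (simp add: u between_def)
  then have left: "sorted (between i m xs)" "\<forall>y \<in> set (between i m ys). m \<le> y"
    by (simp_all add: sorted_append)
  have "sorted (between m j xs @ m # between m j ys)"
    using assms(3,5) by (simp add: u between_def)
  then have right: "sorted (between m j ys)" "\<forall>x \<in> set (between m j xs). x \<le> m"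
    by (simp_all add: sorted_append)
  have x: "between i j xs = between i m xs"
    unfolding between_def
  proof (rule filter_cong[OF refl])
    fix z assume "z \<in> set xs"
    then have "m \<le> z \<Longrightarrow> z \<le> j \<Longrightarrow> z \<le> m" using right(2) by (simp add: set_between)
    then show "(i \<le> z \<and> z \<le> j) = (i \<le> z \<and> z \<le> m)" using assms(5) by linarith
  qed
  have y: "between i j ys = between m j ys"
    unfolding between_def
  proof (rule filter_cong[OF refl])
    fix z assume "z \<in> set ys"
    then have "i \<le> z \<Longrightarrow> z \<le> m \<Longrightarrow> m \<le> z" using left(2) by (simp add: set_between)
    then show "(i \<le> z \<and> z \<le> j) = (m \<le> z \<and> z \<le> j)" using assms(4) by linarith
  qed
  have "between i j u = between i m xs @ m # between m j ys"
    using assms(4,5) x y by (simp add: u between_def)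
  then show ?thesis
    using left(1) right(1) by (auto simp: sorted_append set_between intro: le_trans)
qed

text \<open>This reduces intervals between arbitrary values of the support to neighbouring ones: an
  interval with a value of the support in its interior is cut there and glued again.\<close>

lemma sorted_between_transfer:
  assumes s: "set u = set v"
    and nb: "\<And>i j. i \<in> set u \<Longrightarrow> j \<in> set u \<Longrightarrow> i < j \<Longrightarrow>
      neighbours_sorted i j u \<Longrightarrow> neighbours_sorted i j v"
  shows "i \<in> set u \<Longrightarrow> j \<in> set u \<Longrightarrow> sorted (between i j u) \<Longrightarrow> sorted (between i j v)"
proof (induction "j - i" arbitrary: i j rule: less_induct)
  case less
  consider "j \<le> i" | "i < j" "set u \<inter> {i<..<j} = {}"
    | m where "m \<in> set u" "i < m" "m < j"
    by (metis disjoint_iff greaterThanLessThan_iff not_le)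
  then show ?case
  proof cases
    case 1
    then show ?thesis by (auto simp: set_between intro!: sorted_constant[of _ i])
  next
    case 2
    then show ?thesis using nb[of i j] less.prems by (auto simp: neighbours_sorted_def)
  next
    case 3
    have "sorted (between i m u)" "sorted (between m j u)"
      using 3 by (auto intro: sorted_between_mono[OF less.prems(3)])
    then have "sorted (between i m v)" "sorted (between m j v)"
      using less.hyps[of m i] less.hyps[of j m] 3 less.prems(1,2) by simp_all
    moreover have "m \<in> set v" "i \<le> m" "m \<le> j" using 3 s by auto
    ultimately show ?thesis using sorted_between_glue by blast
  qed
qed

lemma P_hypo_eq_iff_neighbours:
  "P_hypo u = P_hypo v \<longleftrightarrow> mset u = mset v \<and>
     (\<forall>i \<in> set u. \<forall>j \<in> set u. i < j \<longrightarrow> neighbours_sorted i j u = neighbours_sorted i j v)"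
  (is "?lhs \<longleftrightarrow> ?rhs")
proof
  assume ?lhs
  then have r: "mset u = mset v" "\<And>i j. i \<in> set u \<Longrightarrow> j \<in> set u \<Longrightarrow> i \<le> j \<Longrightarrow>
      sorted (between i j u) = sorted (between i j v)"
    unfolding P_hypo_eq_iff by blast+
  moreover have "set u = set v" by (rule mset_eq_setD[OF r(1)])
  ultimately show ?rhs by (simp add: neighbours_sorted_def)
next
  assume r: ?rhs
  then have s: "set u = set v" by (auto dest: mset_eq_setD)
  have "sorted (between i j u) = sorted (between i j v)" if "i \<in> set u" "j \<in> set u" for i j
    using sorted_between_transfer[of u v i j] sorted_between_transfer[of v u i j] r s that by auto
  then show ?lhs unfolding P_hypo_eq_iff using r by blast
qed

text \<open>The two alternatives are the two summands of the upper right entry of a product of upper triangular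
  \<open>2 \<times> 2\<close> matrices. They exclude each other, so the sum of the two indicators is never
  \<open>1 + 1\<close>, which need be neither \<open>0\<close> nor \<open>1\<close> in a semiring.\<close>

lemma neighbours_sorted_append:
  assumes "i < j"
  shows "neighbours_sorted i j (u @ v) \<longleftrightarrow>
    (if j \<in> set u then neighbours_sorted i j u \<and> set v \<inter> {i..<j} = {}
     else set u \<inter> {i<..j} = {} \<and> neighbours_sorted i j v)"
proof -
  let ?cross = "\<forall>x \<in> set (between i j u). \<forall>y \<in> set (between i j v). x \<le> y"
  have split: "neighbours_sorted i j (u @ v) \<longleftrightarrow>
      (j \<in> set u \<or> j \<in> set v) \<and> set u \<inter> {i<..<j} = {} \<and> set v \<inter> {i<..<j} = {} \<and>
      sorted (between i j u) \<and> sorted (between i j v) \<and> ?cross"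
    by (simp add: neighbours_sorted_def between_append sorted_append Int_Un_distrib2 conj_ac)
  have lo: "{i<..j} = insert j {i<..<j}" and hi: "{i..<j} = insert i {i<..<j}"
    using assms by auto
  show ?thesis
  proof (cases "j \<in> set u")
    case True
    have "?cross \<and> set v \<inter> {i<..<j} = {} \<and> sorted (between i j v) \<longleftrightarrow> set v \<inter> {i..<j} = {}"
    proof (intro iffI conjI)
      assume *: "?cross \<and> set v \<inter> {i<..<j} = {} \<and> sorted (between i j v)"
      have "j \<in> set (between i j u)" using True assms by (simp add: set_between)
      then have "i \<notin> set (between i j v)" using * assms by (meson not_le)
      then have "i \<notin> set v" using assms by (simp add: set_between)
      then show "set v \<inter> {i..<j} = {}" using * by (simp add: hi)
    next
      assume v: "set v \<inter> {i..<j} = {}"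
      then show "set v \<inter> {i<..<j} = {}" by (simp add: hi)
      have j: "\<forall>y \<in> set (between i j v). y = j"
      proof
        fix y assume "y \<in> set (between i j v)"
        then have "y \<in> set v" "i \<le> y" "y \<le> j" by (simp_all add: set_between)
        then show "y = j" using v by (cases "y < j") auto
      qed
      then show "sorted (between i j v)" by (rule sorted_constant)
      show ?cross using j by (auto simp: set_between)
    qed
    then show ?thesis unfolding split using True by (simp add: neighbours_sorted_def) blast
  next
    case False
    have "?cross \<and> set u \<inter> {i<..<j} = {} \<and> sorted (between i j u) \<longleftrightarrow> set u \<inter> {i<..j} = {}"
      if "j \<in> set v"
    proof (intro iffI conjI)
      assume "?cross \<and> set u \<inter> {i<..<j} = {} \<and> sorted (between i j u)"
      then show "set u \<inter> {i<..j} = {}" using False by (simp add: lo)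
    next
      assume u: "set u \<inter> {i<..j} = {}"
      then show "set u \<inter> {i<..<j} = {}" by (simp add: lo)
      have i: "\<forall>y \<in> set (between i j u). y = i"
      proof
        fix y assume "y \<in> set (between i j u)"
        then have "y \<in> set u" "i \<le> y" "y \<le> j" by (simp_all add: set_between)
        then show "y = i" using u by (cases "i < y") auto
      qed
      then show "sorted (between i j u)" by (rule sorted_constant)
      show ?cross using i by (auto simp: set_between)
    qed
    then show ?thesis unfolding split using False by (simp add: neighbours_sorted_def) blast
  qed
qed

section \<open>The blocks as morphisms from the free monoid\<close>

definition upper2 :: "'a \<Rightarrow> 'a \<Rightarrow> 'a \<Rightarrow> 'a :: comm_semiring_1 mat" where
  "upper2 a b c = mat 2 2 (\<lambda>(p, q). if q < p then 0 else if p = 1 then c else if q = 0 then a else b)"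

lemma upper2_index:
  "upper2 a b c $$ (0, 0) = a" "upper2 a b c $$ (0, Suc 0) = b"
  "upper2 a b c $$ (Suc 0, 0) = 0" "upper2 a b c $$ (Suc 0, Suc 0) = c"
  by (simp_all add: upper2_def)

lemma upper2_carrier: "upper2 a b c \<in> carrier_mat 2 2"
  by (simp add: upper2_def)

lemma upper2_mult:
  "upper2 a b c * upper2 a' b' c' = upper2 (a * a') (a * b' + b * c') (c * c')"
proof (rule eq_matI)
  fix p q
  assume "p < dim_row (upper2 (a * a') (a * b' + b * c') (c * c'))"
    and "q < dim_col (upper2 (a * a') (a * b' + b * c') (c * c'))"
  then have pq: "p = 0 \<or> p = Suc 0" "q = 0 \<or> q = Suc 0" by (auto simp: upper2_def)
  have dim: "dim_row (upper2 x y z) = Suc (Suc 0)" "dim_col (upper2 x y z) = Suc (Suc 0)"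
    for x y z :: 'a by (simp_all add: upper2_def)
  show "(upper2 a b c * upper2 a' b' c') $$ (p, q)
      = upper2 (a * a') (a * b' + b * c') (c * c') $$ (p, q)"
    using pq by (elim disjE) (simp_all add: dim scalar_prod_def upper2_index)
qed (simp_all add: upper2_def)

lemma upper2_one: "upper2 1 0 1 = 1\<^sub>m 2"
  by (rule eq_matI) (auto simp: upper2_def)

text \<open>Closed forms of the products of the letter matrices: the diagonal entries of a block for \<open>i < j\<close>
  vanish once a letter of \<open>{i<..j}\<close>, respectively \<open>{i..<j}\<close>, occurs. In this form it is
  evident on which data of the word a block depends, whereas multiplicativity needs a proof.\<close>

definition block :: "'a :: comm_semiring_1 \<Rightarrow> nat \<times> nat \<Rightarrow> nat list \<Rightarrow> 'a mat" where
  "block s = (\<lambda>(i, j) u.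
     if i = j then mat 1 1 (\<lambda>_. s ^ count_list u i)
     else upper2 (of_bool (set u \<inter> {i<..j} = {})) (of_bool (neighbours_sorted i j u))
       (of_bool (set u \<inter> {i..<j} = {})))"

definition block_size :: "nat \<times> nat \<Rightarrow> nat" where
  "block_size = (\<lambda>(i, j). if i = j then 1 else 2)"

lemma block_carrier: "block s p u \<in> carrier_mat (block_size p) (block_size p)"
  by (auto simp: block_def block_size_def upper2_carrier split: prod.splits)

lemma upper_triangular_block: "upper_triangular (block s p u)"
  by (auto simp: block_def upper2_def upper_triangular_def split: prod.splits)

lemma block_Nil:
  "block s p [] = 1\<^sub>m (block_size p)"
  by (auto simp: block_def block_size_def neighbours_sorted_def upper2_one split: prod.splits)

lemma block_append:
  fixes s :: "'a :: comm_semiring_1"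
  assumes "fst p \<le> snd p"
  shows "block s p (u @ v) = block s p u * block s p v"
proof -
  obtain i j where p: "p = (i, j)" by (cases p)
  show ?thesis
  proof (cases "i = j")
    case True
    then show ?thesis
      by (intro eq_matI) (auto simp: p block_def scalar_prod_def power_add)
  next
    case False
    then have ij: "i < j" using assms p by simp
    have diag: "of_bool (set (u @ v) \<inter> A = {})
        = of_bool (set u \<inter> A = {}) * (of_bool (set v \<inter> A = {}) :: 'a)" for A
      unfolding of_bool_conj[symmetric] by (simp add: Int_Un_distrib2)
    have "j \<in> set u \<Longrightarrow> set u \<inter> {i<..j} \<noteq> {}" using ij by auto
    then have corner: "of_bool (neighbours_sorted i j (u @ v)) =
        of_bool (set u \<inter> {i<..j} = {}) * of_bool (neighbours_sorted i j v) +
        (of_bool (neighbours_sorted i j u) * of_bool (set v \<inter> {i..<j} = {}) :: 'a)"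
      unfolding neighbours_sorted_append[OF ij]
      by (cases "j \<in> set u") (simp_all add: neighbours_sorted_def of_bool_conj)
    show ?thesis
      using False by (simp add: p block_def upper2_mult diag corner del: set_append)
  qed
qed

section \<open>Block-diagonal matrices\<close>

lemma diag_block_mat_map_carrier:
  assumes "\<And>x. x \<in> set xs \<Longrightarrow> f x \<in> carrier_mat (d x) (d x)"
  shows "diag_block_mat (map f xs) \<in> carrier_mat (sum_list (map d xs)) (sum_list (map d xs))"
  using assms by (induction xs) (auto simp: Let_def)

lemma diag_block_mat_map_mult:
  fixes f g :: "'b \<Rightarrow> 'a :: comm_semiring_1 mat"
  assumes "\<And>x. x \<in> set xs \<Longrightarrow> f x \<in> carrier_mat (d x) (d x)"
    and "\<And>x. x \<in> set xs \<Longrightarrow> g x \<in> carrier_mat (d x) (d x)"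
  shows "diag_block_mat (map f xs) * diag_block_mat (map g xs)
    = diag_block_mat (map (\<lambda>x. f x * g x) xs)"
  using assms
proof (induction xs)
  case (Cons x xs)
  define m where "m = sum_list (map d xs)"
  have D: "diag_block_mat (map f xs) \<in> carrier_mat m m" "diag_block_mat (map g xs) \<in> carrier_mat m m"
    unfolding m_def using Cons.prems by (auto intro: diag_block_mat_map_carrier)
  have x: "f x \<in> carrier_mat (d x) (d x)" "g x \<in> carrier_mat (d x) (d x)"
    using Cons.prems by auto
  have IH: "diag_block_mat (map f xs) * diag_block_mat (map g xs)
      = diag_block_mat (map (\<lambda>x. f x * g x) xs)"
    using Cons by auto
  then have D2: "diag_block_mat (map (\<lambda>x. f x * g x) xs) \<in> carrier_mat m m"
    using mult_carrier_mat[OF D] by simp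
  have fg: "f x * g x \<in> carrier_mat (d x) (d x)" using mult_carrier_mat[OF x] .
  show ?case
    using fg x D D2 mult_four_block_mat[OF x(1) zero_carrier_mat zero_carrier_mat D(1)
        x(2) zero_carrier_mat zero_carrier_mat D(2)]
    by (simp add: Let_def IH)
qed simp

lemma upper_triangular_diag_block_mat_map:
  assumes "\<And>x. x \<in> set xs \<Longrightarrow> f x \<in> carrier_mat (d x) (d x) \<and> upper_triangular (f x)"
  shows "upper_triangular (diag_block_mat (map f xs))"
  using assms
proof (induction xs)
  case (Cons x xs)
  have D: "diag_block_mat (map f xs) \<in> carrier_mat (sum_list (map d xs)) (sum_list (map d xs))"
    using Cons.prems by (auto intro: diag_block_mat_map_carrier)
  have x: "f x \<in> carrier_mat (d x) (d x)" "upper_triangular (f x)" using Cons.prems by auto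
  have "upper_triangular (diag_block_mat (map f xs))" using Cons by auto
  then show ?case
    using upper_triangular_four_block[OF x(1) D x(2)] x(1) D by (simp add: Let_def)
qed (simp add: upper_triangular_def)

text \<open>The dimensions have to be given, since matrices with a different division into blocks may
  be equal.\<close>

lemma four_block_mat_diag_inject:
  assumes "four_block_mat A B C D = four_block_mat A' B' C' D'"
    and "A \<in> carrier_mat n n" "A' \<in> carrier_mat n n" "D \<in> carrier_mat m m" "D' \<in> carrier_mat m m"
  shows "A = A' \<and> D = D'"
proof
  have dim: "dim_row A = n" "dim_col A = n" "dim_row A' = n" "dim_col A' = n"
    "dim_row D = m" "dim_col D = m" "dim_row D' = m" "dim_col D' = m"
    using assms(2-5) by simp_all
  have e: "four_block_mat A B C D $$ (i, j) = four_block_mat A' B' C' D' $$ (i, j)" for i j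
    using assms(1) by (rule arg_cong)
  show "A = A'"
  proof (rule eq_matI)
    fix i j assume "i < dim_row A'" "j < dim_col A'"
    then show "A $$ (i, j) = A' $$ (i, j)" using e[of i j] by (simp add: dim)
  qed (simp_all add: dim)
  show "D = D'"
  proof (rule eq_matI)
    fix i j assume "i < dim_row D'" "j < dim_col D'"
    then show "D $$ (i, j) = D' $$ (i, j)" using e[of "n + i" "n + j"] by (simp add: dim)
  qed (simp_all add: dim)
qed

lemma diag_block_mat_map_inject:
  assumes "\<And>x. x \<in> set xs \<Longrightarrow> f x \<in> carrier_mat (d x) (d x)"
    and "\<And>x. x \<in> set xs \<Longrightarrow> g x \<in> carrier_mat (d x) (d x)"
    and "diag_block_mat (map f xs) = diag_block_mat (map g xs)"
  shows "\<forall>x \<in> set xs. f x = g x"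
  using assms
proof (induction xs)
  case (Cons x xs)
  have f: "f x \<in> carrier_mat (d x) (d x)" "g x \<in> carrier_mat (d x) (d x)"
    and rest: "\<And>y. y \<in> set xs \<Longrightarrow> f y \<in> carrier_mat (d y) (d y)"
      "\<And>y. y \<in> set xs \<Longrightarrow> g y \<in> carrier_mat (d y) (d y)"
    using Cons.prems(1,2) by simp_all
  have "f x = g x \<and> diag_block_mat (map f xs) = diag_block_mat (map g xs)"
    using Cons.prems(3)[unfolded list.map diag_block_mat.simps Let_def] f
      diag_block_mat_map_carrier[OF rest(1)] diag_block_mat_map_carrier[OF rest(2)]
    by (rule four_block_mat_diag_inject)
  then show ?case using Cons.IH[OF rest] by simp
qed simp

section \<open>The representation of the hypoplactic monoid\<close>

definition block_indices :: "nat \<Rightarrow> (nat \<times> nat) list" where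
  "block_indices n = concat (map (\<lambda>j. map (\<lambda>i. (i, j)) [1..<Suc j]) [1..<Suc n])"

lemma set_block_indices: "set (block_indices n) = {(i, j). 1 \<le> i \<and> i \<le> j \<and> j \<le> n}"
  by (auto simp: block_indices_def image_iff simp del: upt_Suc)

text \<open>The blocks \<open>(i, j)\<close> with fixed \<open>j\<close> contribute the odd number \<open>2 (j - 1) + 1\<close>.\<close>

lemma sum_block_size: "sum_list (map block_size (block_indices n)) = n\<^sup>2"
proof (induction n)
  case 0
  then show ?case by (simp add: block_indices_def)
next
  case (Suc n)
  have "sum_list (map (\<lambda>i. block_size (i, Suc n)) [1..<Suc n]) = sum_list (map (\<lambda>i. 2) [1..<Suc n])"
    by (rule arg_cong[where f = sum_list], rule map_cong) (auto simp: block_size_def)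
  then have "sum_list (map block_size (map (\<lambda>i. (i, Suc n)) [1..<Suc (Suc n)])) = 2 * n + 1"
    by (simp add: sum_list_triv o_def block_size_def del: upt_Suc) (simp add: block_size_def)
  moreover have "block_indices (Suc n)
      = block_indices n @ map (\<lambda>i. (i, Suc n)) [1..<Suc (Suc n)]"
    by (simp add: block_indices_def)
  ultimately show ?case using Suc by (simp add: power2_eq_square del: upt_Suc)
qed

definition rep :: "'a :: comm_semiring_1 \<Rightarrow> nat \<Rightarrow> nat list \<Rightarrow> 'a mat" where
  "rep s n u = diag_block_mat (map (\<lambda>p. block s p u) (block_indices n))"

lemma rep_in_UT: "rep s n u \<in> carrier (UT (n\<^sup>2))"
  using diag_block_mat_map_carrier[of "block_indices n" "\<lambda>p. block s p u" block_size,
      OF block_carrier]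
    upper_triangular_diag_block_mat_map[of "block_indices n" "\<lambda>p. block s p u" block_size]
  by (simp add: UT_def rep_def sum_block_size block_carrier upper_triangular_block)

lemma rep_append: "rep s n (u @ v) = rep s n u * rep s n v"
proof -
  have "rep s n u * rep s n v
      = diag_block_mat (map (\<lambda>p. block s p u * block s p v) (block_indices n))"
    unfolding rep_def by (intro diag_block_mat_map_mult[of _ _ block_size] block_carrier)
  also have "\<dots> = rep s n (u @ v)"
    unfolding rep_def
    by (rule arg_cong[where f = diag_block_mat], rule map_cong)
      (auto simp: set_block_indices block_append)
  finally show ?thesis ..
qed

lemma rep_Nil: "rep s n [] = 1\<^sub>m (n\<^sup>2)"
proof -
  let ?As = "map (\<lambda>p. block s p []) (block_indices n)"
  have "rep s n [] = diag_block_mat (map (\<lambda>A. 1\<^sub>m (dim_row A)) ?As)"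
    unfolding rep_def
    by (rule arg_cong[where f = diag_block_mat])
      (auto simp: set_block_indices block_Nil)
  also have "\<dots> = 1\<^sub>m (sum_list (map dim_row ?As))" by (rule diag_block_one_mat)
  also have "map dim_row ?As = map block_size (block_indices n)"
    by (simp add: carrier_matD[OF block_carrier])
  finally show ?thesis by (simp add: sum_block_size)
qed

lemma block_diagonal_rep: "block_diagonal (map block_size (block_indices n)) (rep s n u)"
  unfolding block_diagonal_def rep_def
  by (rule exI[of _ "map (\<lambda>p. block s p u) (block_indices n)"])
    (simp add: carrier_matD[OF block_carrier])

text \<open>If neither \<open>i\<close> nor any value strictly between \<open>i\<close> and \<open>j\<close> occurs, the interval holds only
  letters \<open>j\<close>, and the order of the letters has no
  influence.\<close>

lemma neighbours_sorted_left_absent: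
  assumes "i \<notin> set u"
  shows "neighbours_sorted i j u \<longleftrightarrow> j \<in> set u \<and> set u \<inter> {i<..<j} = {}"
proof -
  have "sorted (between i j u)" if "set u \<inter> {i<..<j} = {}"
  proof (rule sorted_constant[of _ j], rule ballI)
    fix x assume "x \<in> set (between i j u)"
    then have "x \<in> set u" "i \<le> x" "x \<le> j" by (simp_all add: set_between)
    moreover have "x \<noteq> i" using \<open>x \<in> set u\<close> assms by blast
    moreover have "x \<notin> {i<..<j}" using \<open>x \<in> set u\<close> that by blast
    ultimately show "x = j" by simp
  qed
  then show ?thesis by (auto simp: neighbours_sorted_def)
qed

text \<open>The data in \<open>P_hypo_eq_iff_neighbours\<close> other than the content are the upper right entries of the
  blocks \<open>(i, j)\<close> with both \<open>i\<close> and \<open>j\<close> in the support; all other entries are determined by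
  the content. Injectivity of \<open>k \<mapsto> s ^ k\<close> recovers the content.\<close>

lemma rep_eq_iff:
  fixes s :: "'a :: comm_semiring_1"
  assumes s: "inj (\<lambda>k :: nat. s ^ k)" and u: "u \<in> lists {1..n}" and v: "v \<in> lists {1..n}"
  shows "rep s n u = rep s n v \<longleftrightarrow> P_hypo u = P_hypo v"
proof
  assume "rep s n u = rep s n v"
  then have "\<forall>p \<in> set (block_indices n). block s p u = block s p v"
    unfolding rep_def by (intro diag_block_mat_map_inject[of _ _ block_size] block_carrier)
  then have eq: "block s (i, j) u = block s (i, j) v" if "1 \<le> i" "i \<le> j" "j \<le> n" for i j
    using that by (simp add: set_block_indices)
  have "count_list u x = count_list v x" for x
  proof (cases "x \<in> {1..n}")
    case True
    then have "block s (x, x) u $$ (0, 0) = block s (x, x) v $$ (0, 0)" using eq by simp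
    then show ?thesis using s by (auto simp: block_def dest: injD)
  next
    case False
    then have "x \<notin> set u" "x \<notin> set v" using u v by auto
    then show ?thesis by simp
  qed
  then have "mset u = mset v" by (intro multiset_eqI) (simp add: count_mset)
  moreover have "neighbours_sorted i j u = neighbours_sorted i j v"
    if "i \<in> set u" "j \<in> set u" "i < j" for i j
  proof -
    have "1 \<le> i" "j \<le> n" using that u by auto
    then have "block s (i, j) u $$ (0, 1) = block s (i, j) v $$ (0, 1)" using eq that by simp
    then show ?thesis using that by (simp add: block_def upper2_index of_bool_eq_iff)
  qed
  ultimately show "P_hypo u = P_hypo v" unfolding P_hypo_eq_iff_neighbours by blast
next
  assume "P_hypo u = P_hypo v"
  then have m: "mset u = mset v"
    and nb: "\<And>i j. i \<in> set u \<Longrightarrow> j \<in> set u \<Longrightarrow> i < j \<Longrightarrow>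
      neighbours_sorted i j u = neighbours_sorted i j v"
    unfolding P_hypo_eq_iff_neighbours by blast+
  have set: "set u = set v" by (rule mset_eq_setD[OF m])
  have count: "count_list u x = count_list v x" for x using m by (metis count_mset)
  have "neighbours_sorted i j u = neighbours_sorted i j v" if "i < j" for i j
  proof (cases "i \<in> set u \<and> j \<in> set u")
    case True
    then show ?thesis using nb that by blast
  next
    case False
    then consider "j \<notin> set u" | "i \<notin> set u" by blast
    then show ?thesis
    proof cases
      case 1
      then show ?thesis by (simp add: neighbours_sorted_def set)
    next
      case 2
      then show ?thesis using set by (simp add: neighbours_sorted_left_absent)
    qed
  qed
  then have "block s p u = block s p v" if "p \<in> set (block_indices n)" for p
    using that by (auto simp: set_block_indices block_def set count)
  then show "rep s n u = rep s n v" unfolding rep_def by (metis (no_types, lifting) map_cong)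
qed

theorem theorem3p5:
  fixes n :: nat
  assumes "n > 0"
    and "\<exists>s :: 'a :: comm_semiring_1. inj (\<lambda>k :: nat. s ^ k)"
  shows "\<exists>\<phi> :: nat list set \<Rightarrow> 'a mat.
      \<phi> \<in> hom (hypo n) (UT (n^2)) \<and>
      \<phi> \<one>\<^bsub>hypo n\<^esub> = \<one>\<^bsub>UT (n^2)\<^esub> \<and>
      inj_on \<phi> (carrier (hypo n)) \<and>
      (\<exists>ks :: nat list. (\<forall>k \<in> set ks. k > 0) \<and> sum_list ks = n^2 \<and>
         Max (set ks) = (if n = 1 then 1 else 2) \<and>
         (\<forall>X \<in> carrier (hypo n). block_diagonal ks (\<phi> X)))"
proof -
  obtain s :: 'a where s: "inj (\<lambda>k :: nat. s ^ k)" using assms(2) by blast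
  let ?W = "lists {1..n}"
  define cls where "cls u = hypo_rel n `` {u}" for u
  define \<phi> where "\<phi> X = the_elem (rep s n ` X)" for X
  have cls: "cls u = {v \<in> ?W. P_hypo v = P_hypo u}" if "u \<in> ?W" for u
    using that by (auto simp: cls_def hypo_rel_def)
  have carrier: "X \<in> carrier (hypo n) \<longleftrightarrow> (\<exists>u \<in> ?W. X = cls u)" for X
    by (auto simp: hypo_def quotient_def cls_def)
  have \<phi>: "\<phi> (cls u) = rep s n u" if "u \<in> ?W" for u
  proof -
    have "rep s n ` cls u = {rep s n u}"
      using that rep_eq_iff[OF s] by (auto simp: cls)
    then show ?thesis by (simp add: \<phi>_def)
  qed
  \<comment> \<open>That the product of classes does not depend on representatives is inherited from \<open>rep\<close>, which is
    multiplicative and has exactly the hypoplactic classes as its fibres.\<close>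
  have mult: "cls u \<otimes>\<^bsub>hypo n\<^esub> cls v = cls (u @ v)" if uv: "u \<in> ?W" "v \<in> ?W" for u v
  proof -
    have "cls (x @ y) = cls (u @ v)" if "x \<in> cls u" "y \<in> cls v" for x y
    proof -
      have xy: "x \<in> ?W" "y \<in> ?W" "P_hypo x = P_hypo u" "P_hypo y = P_hypo v"
        using that uv by (auto simp: cls)
      have "rep s n (x @ y) = rep s n (u @ v)"
        unfolding rep_append using xy uv rep_eq_iff[OF s] by metis
      then have "P_hypo (x @ y) = P_hypo (u @ v)"
        using rep_eq_iff[OF s, of "x @ y" n "u @ v"] xy uv by simp
      then show ?thesis using xy(1,2) uv cls[of "x @ y"] cls[of "u @ v"] by simp
    qed
    moreover have "u \<in> cls u" "v \<in> cls v" using uv by (auto simp: cls)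
    moreover have "cls u \<otimes>\<^bsub>hypo n\<^esub> cls v = (\<Union>x \<in> cls u. \<Union>y \<in> cls v. cls (x @ y))"
      by (simp add: hypo_def cls_def)
    ultimately show ?thesis by blast
  qed
  have "\<phi> \<in> hom (hypo n) (UT (n\<^sup>2))"
  proof (rule homI)
    fix X assume "X \<in> carrier (hypo n)"
    then obtain u where "u \<in> ?W" "X = cls u" unfolding carrier by blast
    then show "\<phi> X \<in> carrier (UT (n\<^sup>2))" by (simp only: \<phi> rep_in_UT)
  next
    fix X Y assume "X \<in> carrier (hypo n)" "Y \<in> carrier (hypo n)"
    then obtain u v where uv: "u \<in> ?W" "v \<in> ?W" "X = cls u" "Y = cls v" by (auto simp: carrier)
    have "u @ v \<in> ?W" using uv by simp
    from \<phi>[OF this] show "\<phi> (X \<otimes>\<^bsub>hypo n\<^esub> Y) = \<phi> X \<otimes>\<^bsub>UT (n\<^sup>2)\<^esub> \<phi> Y"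
      using uv by (simp add: mult \<phi> rep_append UT_def)
  qed
  moreover have "\<phi> \<one>\<^bsub>hypo n\<^esub> = \<one>\<^bsub>UT (n\<^sup>2)\<^esub>"
  proof -
    have "\<one>\<^bsub>hypo n\<^esub> = cls []" by (simp add: hypo_def cls_def)
    then show ?thesis using \<phi>[of "[]"] by (simp add: rep_Nil UT_def)
  qed
  moreover have "inj_on \<phi> (carrier (hypo n))"
  proof (rule inj_onI)
    fix X Y assume "X \<in> carrier (hypo n)" "Y \<in> carrier (hypo n)" and eq: "\<phi> X = \<phi> Y"
    then obtain u v where uv: "u \<in> ?W" "v \<in> ?W" "X = cls u" "Y = cls v" by (auto simp: carrier)
    then have "P_hypo u = P_hypo v" using eq rep_eq_iff[OF s] by (simp add: \<phi>)
    then show "X = Y" using uv by (simp add: cls)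
  qed
  moreover have "Max (set (map block_size (block_indices n))) = (if n = 1 then 1 else 2)"
  proof (cases "n = 1")
    case True
    then show ?thesis by (simp add: block_indices_def block_size_def)
  next
    case False
    have "block_size p \<le> 2" for p by (auto simp: block_size_def split: prod.splits)
    moreover have "(1, 2) \<in> set (block_indices n)" using False assms(1) by (simp add: set_block_indices)
    then have "2 \<in> set (map block_size (block_indices n))"
      unfolding set_map by (rule rev_image_eqI) (simp add: block_size_def)
    ultimately have "Max (set (map block_size (block_indices n))) = 2" by (intro Max_eqI) auto
    then show ?thesis using False by simp
  qed
  moreover have "\<forall>k \<in> set (map block_size (block_indices n)). k > 0"
    by (auto simp: block_size_def)
  moreover have "\<forall>X \<in> carrier (hypo n). block_diagonal (map block_size (block_indices n)) (\<phi> X)"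
  proof
    fix X assume "X \<in> carrier (hypo n)"
    then obtain u where "u \<in> ?W" "X = cls u" unfolding carrier by blast
    then show "block_diagonal (map block_size (block_indices n)) (\<phi> X)"
      by (simp only: \<phi> block_diagonal_rep)
  qed
  ultimately show ?thesis using sum_block_size by blast
qed

end
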